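(* Fix $L>0$. Consider the Runge-Kutta scheme which, with step size $h>0$ and applied to the gradient system $\frac{d}{dt}x=-\nabla V(x)$, reads $$x_1 = x_0 - h\,\nabla V\Big(x_0-\frac{h}{2}\nabla V(x_0)\Big).$$ Then for each arbitrarily small value of $h>0$ (that is, there is $h_0=h_0(L)>0$ such that for every $h\in(0,h_0]$) there exist a dimension $d\geq 1$, a convex, $L$-smooth function $V:\mathbb{R}^d\to\mathbb{R}$ and initial points $x_0,\widetilde x_0\in\mathbb{R}^d$ such that the points $$x_1 = x_0 - h\,\nabla V\Big(x_0-\frac{h}{2}\nabla V(x_0)\Big),\qquad \widetilde x_1 = \widetilde x_0 - h\,\nabla V\Big(\widetilde x_0-\frac{h}{2}\nabla V(\widetilde x_0)\Big)$$ do not satisfy $\|\widetilde x_1-x_1\|\leq\|\widetilde x_0-x_0\|$, i.e. $\|\widetilde x_1-x_1\|>\|\widetilde x_0-x_0\|$. As a consequence, the scheme does not possess an interval of convex contractivity.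
   Context: $\langle\cdot,\cdot\rangle$ and $\|\cdot\|$ denote the Euclidean inner product and norm in $\mathbb{R}^d$. A continuously differentiable function $V:\mathbb{R}^d\to\mathbb{R}$ is convex if $\langle \nabla V(x)-\nabla V(y),x-y\rangle\geq 0$ for all $x,y\in\mathbb{R}^d$. It is $L$-smooth if $\|\nabla V(x)-\nabla V(y)\|\leq L\|x-y\|$ for all $x,y\in\mathbb{R}^d$. The scheme considered is the second-order two-stage explicit method of Runge, which for a general system $\frac{d}{dt}y=F(y)$ takes the form $y_1=y_0+hF\big(y_0+\frac{h}{2}F(y_0)\big)$; here $F=-\nabla V$. For fixed $L>0$, an interval $(0,h_c]$ with $h_c=h_c(L)>0$ is called an interval of convex contractivity of a given Runge-Kutta scheme if, for every $h\in(0,h_c]$, every convex, $L$-smooth $V$ (in any dimension $d$), and any two initial points $x_0,\widetilde x_0\in\mathbb{R}^d$, the Runge-Kutta solutions $x_1,\widetilde x_1$ after one step of length $h$ applied to $\frac{d}{dt}x=-\nabla V(x)$, starting from $x_0$ and $\widetilde x_0$ respectively, satisfy $\|\widetilde x_1-x_1\|\leq\|\widetilde x_0-x_0\|$. *)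

theory Defs
  imports "HOL-Analysis.Analysis"
begin

text \<open>
  The dimension \<open>d\<close> is quantified inside the statement, so it cannot be a type.  All the spaces
  \<open>\<real>\<^sup>d\<close> are therefore realised as subspaces of one inner product space \<open>fseq\<close>, the finitely
  supported real sequences with the Euclidean inner product: \<open>Rd d\<close> consists of the sequences
  that vanish from index \<open>d\<close> on.  A function on \<open>\<real>\<^sup>d\<close> is a function on \<open>fseq\<close> of which only the
  values on \<open>Rd d\<close> are ever used.
\<close>

typedef fseq = "{f :: nat \<Rightarrow> real. finite {i. f i \<noteq> 0}}"
  morphisms coord Abs_fseq
  by (rule exI[of _ "\<lambda>_. 0"]) simp

setup_lifting type_definition_fseq

lemma finite_support [simp]: "finite {i. coord x i \<noteq> 0}"
  using coord[of x] by simp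

lemma fseq_eqI: "(\<And>i. coord x i = coord y i) \<Longrightarrow> x = y"
  by (metis coord_inject ext)

instantiation fseq :: real_vector
begin

lift_definition zero_fseq :: fseq is "\<lambda>_. 0" by simp

lift_definition plus_fseq :: "fseq \<Rightarrow> fseq \<Rightarrow> fseq" is "\<lambda>f g i. f i + g i"
  subgoal for f g by (rule finite_subset[of _ "{i. f i \<noteq> 0} \<union> {i. g i \<noteq> 0}"]) auto
  done

lift_definition minus_fseq :: "fseq \<Rightarrow> fseq \<Rightarrow> fseq" is "\<lambda>f g i. f i - g i"
  subgoal for f g by (rule finite_subset[of _ "{i. f i \<noteq> 0} \<union> {i. g i \<noteq> 0}"]) auto
  done

lift_definition uminus_fseq :: "fseq \<Rightarrow> fseq" is "\<lambda>f i. - f i" by simp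

lift_definition scaleR_fseq :: "real \<Rightarrow> fseq \<Rightarrow> fseq" is "\<lambda>c f i. c * f i"
  subgoal for c f by (rule finite_subset[of _ "{i. f i \<noteq> 0}"]) auto
  done

instance
  by standard (transfer; simp add: fun_eq_iff algebra_simps)+

end

lemma coord_simps [simp]:
  "coord 0 i = 0" "coord (x + y) i = coord x i + coord y i"
  "coord (x - y) i = coord x i - coord y i" "coord (- x) i = - coord x i"
  "coord (c *\<^sub>R x) i = c * coord x i"
  by (transfer; simp)+

definition inner_fseq_raw :: "fseq \<Rightarrow> fseq \<Rightarrow> real" where
  "inner_fseq_raw x y = (\<Sum>i | coord x i \<noteq> 0. coord x i * coord y i)"

lemma inner_fseq_raw_superset:
  assumes "finite A" "{i. coord x i \<noteq> 0} \<subseteq> A"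
  shows "inner_fseq_raw x y = (\<Sum>i\<in>A. coord x i * coord y i)"
  unfolding inner_fseq_raw_def using assms by (intro sum.mono_neutral_left) auto

instantiation fseq :: real_inner
begin

definition inner_fseq :: "fseq \<Rightarrow> fseq \<Rightarrow> real" where "inner_fseq = inner_fseq_raw"
definition norm_fseq :: "fseq \<Rightarrow> real" where "norm_fseq x = sqrt (inner x x)"
definition sgn_fseq :: "fseq \<Rightarrow> fseq" where "sgn_fseq x = x /\<^sub>R norm x"
definition dist_fseq :: "fseq \<Rightarrow> fseq \<Rightarrow> real" where "dist_fseq x y = norm (x - y)"
definition uniformity_fseq :: "(fseq \<times> fseq) filter" where
  "uniformity_fseq = (INF e\<in>{0<..}. principal {(x, y). dist x y < e})"
definition open_fseq :: "fseq set \<Rightarrow> bool" where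
  "open_fseq U \<longleftrightarrow> (\<forall>x\<in>U. \<forall>\<^sub>F (x', y) in uniformity. x' = x \<longrightarrow> y \<in> U)"

instance
proof
  fix x y z :: fseq and r :: real
  let ?A = "{i. coord x i \<noteq> 0} \<union> {i. coord y i \<noteq> 0}"
  have fin: "finite ?A" by simp
  have *: "inner_fseq_raw x z = (\<Sum>i\<in>?A. coord x i * coord z i)"
    "inner_fseq_raw y z = (\<Sum>i\<in>?A. coord y i * coord z i)" for z
    by (rule inner_fseq_raw_superset[OF fin]; auto)+
  show "inner x y = inner y x"
    unfolding inner_fseq_def * by (simp add: mult.commute)
  have "inner_fseq_raw (x + y) z = (\<Sum>i\<in>?A. coord (x + y) i * coord z i)"
    by (rule inner_fseq_raw_superset[OF fin]) auto
  then show "inner (x + y) z = inner x z + inner y z"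
    unfolding inner_fseq_def * by (simp add: algebra_simps sum.distrib)
  have "inner_fseq_raw (r *\<^sub>R x) y = (\<Sum>i\<in>?A. coord (r *\<^sub>R x) i * coord y i)"
    by (rule inner_fseq_raw_superset[OF fin]) auto
  then show "inner (r *\<^sub>R x) y = r * inner x y"
    unfolding inner_fseq_def * by (simp add: sum_distrib_left mult.assoc)
  show "0 \<le> inner x x"
    unfolding inner_fseq_def inner_fseq_raw_def by (intro sum_nonneg) auto
  show "inner x x = 0 \<longleftrightarrow> x = 0"
    unfolding inner_fseq_def inner_fseq_raw_def
    by (subst sum_nonneg_eq_0_iff) (auto intro: fseq_eqI)
qed (simp_all add: norm_fseq_def sgn_fseq_def dist_fseq_def uniformity_fseq_def open_fseq_def)

end

definition Rd :: "nat \<Rightarrow> fseq set" where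
  "Rd d = {x. \<forall>i\<ge>d. coord x i = 0}"

lemma subspace_Rd: "subspace (Rd d)"
  by (simp add: subspace_def Rd_def)

lemma inner_Rd: "x \<in> Rd d \<Longrightarrow> inner x y = (\<Sum>i<d. coord x i * coord y i)"
  unfolding inner_fseq_def
  by (rule inner_fseq_raw_superset) (auto simp: Rd_def not_le[symmetric])

lemma norm_Rd: "x \<in> Rd d \<Longrightarrow> norm x = sqrt (\<Sum>i<d. (coord x i)\<^sup>2)"
  by (simp add: norm_eq_sqrt_inner inner_Rd power2_eq_square)

text \<open>
  \<open>tuple d f\<close> is the point \<open>(f 0, \<dots>, f (d - 1))\<close> of \<open>\<real>\<^sup>d\<close>.
\<close>

definition tuple :: "nat \<Rightarrow> (nat \<Rightarrow> real) \<Rightarrow> fseq" where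
  "tuple d f = Abs_fseq (\<lambda>i. if i < d then f i else 0)"

lemma coord_tuple [simp]: "coord (tuple d f) i = (if i < d then f i else 0)"
  unfolding tuple_def by (subst Abs_fseq_inverse) auto

lemma tuple_in_Rd [simp]: "tuple d f \<in> Rd d"
  by (simp add: Rd_def)

lemma tuple_coord: "x \<in> Rd d \<Longrightarrow> tuple d (coord x) = x"
  by (rule fseq_eqI) (auto simp: Rd_def)

text \<open>
  The gradient at a point of \<open>\<real>\<^sup>d\<close>: the vector of \<open>\<real>\<^sup>d\<close> that represents the Frechet derivative
  of \<open>V\<close> as a function on \<open>\<real>\<^sup>d\<close> (hence the derivative within \<open>Rd d\<close>).  It exists and is unique
  where \<open>V\<close> is differentiable, see \<open>grad_eqI\<close> and \<open>has_derivative_grad\<close> below.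
\<close>

definition grad :: "nat \<Rightarrow> (fseq \<Rightarrow> real) \<Rightarrow> fseq \<Rightarrow> fseq" where
  "grad d V x = (THE g. g \<in> Rd d \<and> (V has_derivative (\<lambda>v. inner g v)) (at x within Rd d))"

definition C1_on_Rd :: "nat \<Rightarrow> (fseq \<Rightarrow> real) \<Rightarrow> bool" where
  "C1_on_Rd d V \<longleftrightarrow> V differentiable_on Rd d \<and> continuous_on (Rd d) (grad d V)"

definition convex_C1 :: "nat \<Rightarrow> (fseq \<Rightarrow> real) \<Rightarrow> bool" where
  "convex_C1 d V \<longleftrightarrow> C1_on_Rd d V \<and>
     (\<forall>x\<in>Rd d. \<forall>y\<in>Rd d. inner (grad d V x - grad d V y) (x - y) \<ge> 0)"

definition L_smooth :: "real \<Rightarrow> nat \<Rightarrow> (fseq \<Rightarrow> real) \<Rightarrow> bool" where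
  "L_smooth L d V \<longleftrightarrow> C1_on_Rd d V \<and>
     (\<forall>x\<in>Rd d. \<forall>y\<in>Rd d. norm (grad d V x - grad d V y) \<le> L * norm (x - y))"

text \<open>
  A one-step method is represented by the map that sends a step size \<open>h\<close>, a vector field \<open>F\<close> and
  a point to the numerical solution after one step.
\<close>

type_synonym one_step_method = "real \<Rightarrow> (fseq \<Rightarrow> fseq) \<Rightarrow> fseq \<Rightarrow> fseq"

definition runge2 :: one_step_method where
  "runge2 h F y = y + h *\<^sub>R F (y + (h / 2) *\<^sub>R F y)"

definition interval_of_convex_contractivity :: "one_step_method \<Rightarrow> real \<Rightarrow> real \<Rightarrow> bool" where
  "interval_of_convex_contractivity \<Phi> L h\<^sub>c \<longleftrightarrow> h\<^sub>c > 0 \<and>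
     (\<forall>h\<in>{0<..h\<^sub>c}. \<forall>d\<ge>1. \<forall>V. convex_C1 d V \<and> L_smooth L d V \<longrightarrow>
        (\<forall>x\<in>Rd d. \<forall>x'\<in>Rd d.
           norm (\<Phi> h (\<lambda>z. - grad d V z) x' - \<Phi> h (\<lambda>z. - grad d V z) x) \<le> norm (x' - x)))"

lemma has_derivative_Rd_unique:
  assumes x: "x \<in> Rd d" and g: "g \<in> Rd d" and g': "g' \<in> Rd d"
    and D: "(V has_derivative (\<lambda>v. inner g v)) (at x within Rd d)"
    and D': "(V has_derivative (\<lambda>v. inner g' v)) (at x within Rd d)"
  shows "g = g'"
proof -
  let ?w = "g - g'"
  have w: "?w \<in> Rd d" using g g' by (simp add: Rd_def)
  have maps: "(\<lambda>t::real. x + t *\<^sub>R ?w) ` UNIV \<subseteq> Rd d"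
    using x w by (auto simp: Rd_def)
  have lin: "((\<lambda>t::real. x + t *\<^sub>R ?w) has_derivative (\<lambda>t. t *\<^sub>R ?w)) (at 0)"
    by (auto intro!: derivative_eq_intros)
  have "((\<lambda>t. V (x + t *\<^sub>R ?w)) has_derivative (\<lambda>t. inner k (t *\<^sub>R ?w))) (at 0)"
    if "(V has_derivative (\<lambda>v. inner k v)) (at x within Rd d)" for k
  proof -
    have "(V has_derivative (\<lambda>v. inner k v))
        (at (x + 0 *\<^sub>R ?w) within range (\<lambda>t::real. x + t *\<^sub>R ?w))"
      using has_derivative_subset[OF that maps] by simp
    from has_derivative_in_compose[OF lin this] show ?thesis by simp
  qed
  from has_derivative_unique[OF this[OF D] this[OF D']]
  have "inner g (1 *\<^sub>R ?w) = inner g' (1 *\<^sub>R ?w)" by (rule fun_cong)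
  then have "inner ?w ?w = 0" by (simp add: inner_diff_left)
  then show ?thesis by simp
qed

lemma grad_eqI:
  assumes "x \<in> Rd d" "g \<in> Rd d" "(V has_derivative (\<lambda>v. inner g v)) (at x within Rd d)"
  shows "grad d V x = g"
  unfolding grad_def using assms has_derivative_Rd_unique by (intro the_equality) blast+

lemma has_derivative_grad:
  assumes x: "x \<in> Rd d" and V: "V differentiable (at x within Rd d)"
  shows "grad d V x \<in> Rd d"
    and "(V has_derivative (\<lambda>v. inner (grad d V x) v)) (at x within Rd d)"
proof -
  from V obtain D where D: "(V has_derivative D) (at x within Rd d)"
    by (auto simp: differentiable_def)
  then interpret bounded_linear D by (rule has_derivative_bounded_linear)
  define e where "e i = tuple d (\<lambda>j. if j = i then 1 else 0)" for i
  define g where "g = tuple d (\<lambda>i. D (e i))"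
  have D_eq: "D v = inner g v" if v: "v \<in> Rd d" for v
  proof -
    have fin: "coord (\<Sum>i\<in>A. coord v i *\<^sub>R e i) j = (\<Sum>i\<in>A. coord v i * coord (e i) j)" for A j
      by (induction A rule: infinite_finite_induct) auto
    have "coord (\<Sum>i<d. coord v i *\<^sub>R e i) j = coord v j" for j
    proof -
      have "(\<Sum>i<d. coord v i * coord (e i) j) = (\<Sum>i<d. if i = j then coord v j else 0)"
        by (intro sum.cong) (auto simp: e_def)
      then show ?thesis using v by (auto simp: fin Rd_def)
    qed
    then have "v = (\<Sum>i<d. coord v i *\<^sub>R e i)" by (intro fseq_eqI) simp
    then have "D v = D (\<Sum>i<d. coord v i *\<^sub>R e i)" by simp
    also have "\<dots> = (\<Sum>i<d. coord v i * D (e i))"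
      by (simp add: sum scaleR)
    also have "\<dots> = inner g v"
      by (subst inner_Rd[of _ d]) (auto simp: g_def mult.commute)
    finally show ?thesis .
  qed
  have D': "(V has_derivative (\<lambda>v. inner g v)) (at x within Rd d)"
    unfolding has_derivative_within
  proof
    show "bounded_linear (\<lambda>v. inner g v)" by (rule bounded_linear_inner_right)
    have "\<forall>\<^sub>F y in at x within Rd d.
        (1 / norm (y - x)) *\<^sub>R (V y - (V x + D (y - x)))
        = (1 / norm (y - x)) *\<^sub>R (V y - (V x + inner g (y - x)))"
      using x D_eq subspace_diff[OF subspace_Rd]
      by (auto simp: eventually_at intro!: exI[of _ 1])
    with D show "((\<lambda>y. (1 / norm (y - x)) *\<^sub>R (V y - (V x + inner g (y - x)))) \<longlongrightarrow> 0)
        (at x within Rd d)"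
      unfolding has_derivative_within by (blast intro: Lim_transform_eventually)
  qed
  have g: "g \<in> Rd d" by (simp add: g_def)
  from grad_eqI[OF x g D'] g D' show "grad d V x \<in> Rd d"
    and "(V has_derivative (\<lambda>v. inner (grad d V x) v)) (at x within Rd d)" by simp_all
qed

end

theory Submission
  imports Defs
begin

text \<open>
  Write \<open>\<Delta> = y\<^sub>0 - x\<^sub>0\<close>, and let \<open>a\<close> and \<open>b\<close> be the differences of the gradients at the two initial
  points and at the two intermediate points.  One step turns \<open>\<Delta>\<close> into \<open>\<Delta> - h b\<close>, where \<open>b\<close> is
  produced by the displacement \<open>\<Delta> - (h/2) a\<close>.  Monotonicity of the gradient controls the inner
  product of \<open>b\<close> with the latter displacement but not with \<open>\<Delta>\<close>.  Hence expansion results as soon as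
  \<open>b\<close> is nonzero and orthogonal to \<open>\<Delta>\<close>, by Pythagoras.

  This is arranged in the plane by a sum of two functions, each depending on one linear form:
  \<open>V x = (c/2) (max 0 (x\<^sub>1 - x\<^sub>2))\<^sup>2 + (c/2) x\<^sub>2\<^sup>2\<close>.  Let \<open>\<Delta> = (1, 0)\<close> and let both initial points lie
  in the half plane \<open>x\<^sub>1 \<ge> x\<^sub>2\<close>, where the first summand is active.  The first stage then tilts
  \<open>\<Delta>\<close>: the gradient of that summand is a multiple of \<open>(1, -1)\<close>, so it creates a difference in the
  second coordinate.  If the initial points
  have a very negative second coordinate, the second summand pushes both of them across the line
  \<open>x\<^sub>1 = x\<^sub>2\<close> during the first stage, to where the first summand is flat.  There only the second
  summand acts, so that \<open>b\<close> is a nonzero multiple of \<open>(0, 1)\<close>.  The potential is convex, its gradient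
  has Lipschitz constant at most \<open>3 c\<close>, and the construction works for every \<open>h > 0\<close> when the
  initial points are moved far enough out: see \<open>runge2_expands\<close>, which carries the theorem together
  with \<open>convex_kinked_potential\<close> and \<open>L_smooth_kinked_potential\<close>.
\<close>

section \<open>Functions of one linear form\<close>

text \<open>
  The half square of the positive part is twice differentiable except at \<open>0\<close>, where the one-sided
  second derivatives differ; its first derivative is nevertheless continuous.
\<close>

lemma DERIV_half_square_pos_part:
  fixes t :: real
  shows "((\<lambda>t. (max 0 t)\<^sup>2 / 2) has_real_derivative max 0 t) (at t)"
proof -
  consider "t > 0" | "t < 0" | "t = 0" by linarith
  then show ?thesis
  proof cases
    case 1
    have "((\<lambda>t. t\<^sup>2 / 2) has_real_derivative max 0 t) (at t)"
      using 1 by (auto intro!: derivative_eq_intros)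
    then show ?thesis
      by (rule has_field_derivative_transform_within_open[of _ _ _ "{0<..}"]) (use 1 in auto)
  next
    case 2
    have "((\<lambda>t. 0) has_real_derivative max 0 t) (at t)"
      using 2 by (auto intro!: derivative_eq_intros)
    then show ?thesis
      by (rule has_field_derivative_transform_within_open[of _ _ _ "{..<0}"]) (use 2 in auto)
  next
    case 3
    have "((\<lambda>s::real. max 0 s / 2) \<longlongrightarrow> max 0 0 / 2) (at 0)"
      by (intro tendsto_intros) auto
    moreover have "\<forall>\<^sub>F s in at (0::real). max 0 s / 2 = (max 0 s)\<^sup>2 / 2 / s"
      by (auto simp: eventually_at_filter max_def power2_eq_square)
    ultimately show ?thesis
      unfolding 3 has_field_derivative_iff by (auto elim!: Lim_transform_eventually)
  qed
qed

lemma has_derivative_ridge: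
  fixes u x :: "'a::real_inner"
  assumes "(\<phi> has_real_derivative D) (at (inner u x))"
  shows "((\<lambda>x. \<phi> (inner u x)) has_derivative (\<lambda>v. inner (D *\<^sub>R u) v)) (at x within S)"
proof -
  have "((\<lambda>x. inner u x) has_derivative (\<lambda>v. inner u v)) (at x within S)"
    by (auto intro!: derivative_eq_intros)
  from has_derivative_compose[OF this assms[unfolded has_field_derivative_def]]
  show ?thesis by simp
qed

lemma ridge_gradient_monotone:
  fixes u x y :: "'a::real_inner" and f :: "real \<Rightarrow> real"
  assumes "mono f"
  shows "inner (f (inner u x) *\<^sub>R u - f (inner u y) *\<^sub>R u) (x - y) \<ge> 0"
proof -
  have "inner (f (inner u x) *\<^sub>R u - f (inner u y) *\<^sub>R u) (x - y)
      = (f (inner u x) - f (inner u y)) * (inner u x - inner u y)"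
    by (simp add: inner_diff algebra_simps)
  also have "\<dots> \<ge> 0"
    using monoD[OF assms, of "inner u x" "inner u y"] monoD[OF assms, of "inner u y" "inner u x"]
    by (cases "inner u x \<le> inner u y") (auto intro: mult_nonneg_nonneg mult_nonpos_nonpos)
  finally show ?thesis .
qed

lemma ridge_gradient_Lipschitz:
  fixes u x y :: "'a::real_inner" and f :: "real \<Rightarrow> real"
  assumes "\<And>s t. \<bar>f s - f t\<bar> \<le> \<bar>s - t\<bar>"
  shows "norm (f (inner u x) *\<^sub>R u - f (inner u y) *\<^sub>R u) \<le> (norm u)\<^sup>2 * norm (x - y)"
proof -
  have "norm (f (inner u x) *\<^sub>R u - f (inner u y) *\<^sub>R u)
      = \<bar>f (inner u x) - f (inner u y)\<bar> * norm u"
    by (simp flip: scaleR_diff_left)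
  also have "\<dots> \<le> \<bar>inner u (x - y)\<bar> * norm u"
    using assms by (intro mult_right_mono) (auto simp: inner_diff_right)
  also have "\<dots> \<le> (norm u * norm (x - y)) * norm u"
    by (intro mult_right_mono Cauchy_Schwarz_ineq2) auto
  finally show ?thesis by (simp add: power2_eq_square algebra_simps)
qed

section \<open>The potential\<close>

definition point :: "real \<Rightarrow> real \<Rightarrow> fseq" where
  "point a b = tuple 2 (\<lambda>i. if i = 0 then a else b)"

lemma point_in_plane: "point a b \<in> Rd 2"
  by (simp add: point_def)

lemma point_arith:
  "point a b + point a' b' = point (a + a') (b + b')"
  "point a b - point a' b' = point (a - a') (b - b')"
  "k *\<^sub>R point a b = point (k * a) (k * b)"
  by (auto simp: point_def intro!: fseq_eqI)

lemma inner_point: "inner (point a b) (point a' b') = a * a' + b * b'"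
  by (simp add: point_def inner_Rd[of _ 2] numeral_2_eq_2)

lemma norm_point_squared: "(norm (point a b))\<^sup>2 = a\<^sup>2 + b\<^sup>2"
  by (simp add: power2_norm_eq_inner inner_point) (simp add: power2_eq_square)

definition kinked_potential :: "real \<Rightarrow> fseq \<Rightarrow> real" where
  "kinked_potential c x =
     c * ((max 0 (inner (point 1 (-1)) x))\<^sup>2 / 2 + (inner (point 0 1) x)\<^sup>2 / 2)"

definition kinked_gradient :: "real \<Rightarrow> fseq \<Rightarrow> fseq" where
  "kinked_gradient c x =
     c *\<^sub>R (max 0 (inner (point 1 (-1)) x) *\<^sub>R point 1 (-1) + inner (point 0 1) x *\<^sub>R point 0 1)"

lemma kinked_gradient_point:
  "kinked_gradient c (point a b) = point (c * max 0 (a - b)) (c * (b - max 0 (a - b)))"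
  by (simp add: kinked_gradient_def inner_point point_arith algebra_simps)

lemma kinked_gradient_in_plane: "kinked_gradient c x \<in> Rd 2"
  unfolding kinked_gradient_def
  by (intro subspace_scale subspace_add subspace_Rd point_in_plane)

lemma has_derivative_kinked_potential:
  "(kinked_potential c has_derivative (\<lambda>v. inner (kinked_gradient c x) v)) (at x within S)"
proof -
  have "((\<lambda>t::real. t\<^sup>2 / 2) has_real_derivative t) (at t)" for t
    by (auto intro!: derivative_eq_intros)
  note D = has_derivative_ridge[OF this, of "point 0 1"]
    has_derivative_ridge[OF DERIV_half_square_pos_part, of "point 1 (-1)"]
  show ?thesis
    unfolding kinked_potential_def[abs_def] kinked_gradient_def
    by (rule has_derivative_eq_rhs, rule has_derivative_mult_right,
        rule has_derivative_add[OF D(2) D(1)]) (simp add: inner_add_left)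
qed

lemma grad_kinked_potential:
  "x \<in> Rd 2 \<Longrightarrow> grad 2 (kinked_potential c) x = kinked_gradient c x"
  using kinked_gradient_in_plane has_derivative_kinked_potential by (intro grad_eqI)

text \<open>
  The Lipschitz constant \<open>3 c\<close> adds the contributions \<open>c (norm u)\<^sup>2\<close> of the two directions
  \<open>u = (1, -1)\<close> and \<open>u = (0, 1)\<close>, whose squared lengths are \<open>2\<close> and \<open>1\<close>.
\<close>

lemma kinked_gradient_Lipschitz:
  assumes "c \<ge> 0"
  shows "norm (kinked_gradient c x - kinked_gradient c y) \<le> 3 * c * norm (x - y)"
proof -
  let ?u = "point 1 (-1)" and ?e = "point 0 1"
  let ?A = "max 0 (inner ?u x) *\<^sub>R ?u - max 0 (inner ?u y) *\<^sub>R ?u"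
  let ?B = "inner ?e x *\<^sub>R ?e - inner ?e y *\<^sub>R ?e"
  have A: "norm ?A \<le> 2 * norm (x - y)"
    using ridge_gradient_Lipschitz[of "max 0" ?u x y] by (simp add: norm_point_squared max_def)
  have B: "norm ?B \<le> norm (x - y)"
    using ridge_gradient_Lipschitz[of "\<lambda>t. t" ?e x y] by (simp add: norm_point_squared)
  have "kinked_gradient c x - kinked_gradient c y = c *\<^sub>R (?A + ?B)"
    by (simp only: kinked_gradient_def scaleR_add_right scaleR_diff_right)
       (simp add: algebra_simps)
  then have "norm (kinked_gradient c x - kinked_gradient c y) = c * norm (?A + ?B)"
    using assms by simp
  also have "\<dots> \<le> c * (3 * norm (x - y))"
    using norm_triangle_ineq[of ?A ?B] A B assms by (intro mult_left_mono) linarith+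
  finally show ?thesis by simp
qed

lemma kinked_gradient_monotone:
  assumes "c \<ge> 0"
  shows "inner (kinked_gradient c x - kinked_gradient c y) (x - y) \<ge> 0"
proof -
  let ?u = "point 1 (-1)" and ?e = "point 0 1"
  let ?A = "max 0 (inner ?u x) *\<^sub>R ?u - max 0 (inner ?u y) *\<^sub>R ?u"
  let ?B = "inner ?e x *\<^sub>R ?e - inner ?e y *\<^sub>R ?e"
  have A: "inner ?A (x - y) \<ge> 0"
    by (rule ridge_gradient_monotone) (auto intro: monoI)
  have B: "inner ?B (x - y) \<ge> 0"
    by (rule ridge_gradient_monotone[of "\<lambda>t. t"]) (auto intro: monoI)
  have "kinked_gradient c x - kinked_gradient c y = c *\<^sub>R (?A + ?B)"
    by (simp only: kinked_gradient_def scaleR_add_right scaleR_diff_right)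
       (simp add: algebra_simps)
  then have "inner (kinked_gradient c x - kinked_gradient c y) (x - y)
      = c * (inner ?A (x - y) + inner ?B (x - y))"
    by (simp only: inner_scaleR_left inner_add_left)
  also have "\<dots> \<ge> 0" using A B assms by simp
  finally show ?thesis .
qed

lemma C1_kinked_potential: "C1_on_Rd 2 (kinked_potential c)"
proof -
  have "continuous_on (Rd 2) (kinked_gradient c)"
    unfolding kinked_gradient_def[abs_def] by (intro continuous_intros)
  then have "continuous_on (Rd 2) (grad 2 (kinked_potential c))"
    by (simp add: grad_kinked_potential cong: continuous_on_cong)
  moreover have "kinked_potential c differentiable_on Rd 2"
    unfolding differentiable_on_def differentiable_def
    using has_derivative_kinked_potential by blast
  ultimately show ?thesis by (simp add: C1_on_Rd_def)
qed

lemma convex_kinked_potential: "c \<ge> 0 \<Longrightarrow> convex_C1 2 (kinked_potential c)"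
  by (simp add: convex_C1_def C1_kinked_potential grad_kinked_potential kinked_gradient_monotone)

lemma L_smooth_kinked_potential: "c \<ge> 0 \<Longrightarrow> L_smooth (3 * c) 2 (kinked_potential c)"
  by (simp add: L_smooth_def C1_kinked_potential grad_kinked_potential kinked_gradient_Lipschitz)

section \<open>Expansion for every step size\<close>

lemma runge2_gradient:
  "runge2 h (\<lambda>z. - grad d V z) x = x - h *\<^sub>R grad d V (x - (h / 2) *\<^sub>R grad d V x)"
  by (simp add: runge2_def)

text \<open>
  The initial points are \<open>(q, q)\<close> and \<open>(q + 1, q)\<close> with \<open>q\<close> of order \<open>-1/h\<close>: the gradient must be
  this large for a first stage of length \<open>h/2\<close> to carry the second point, which starts at a fixed
  distance from the line \<open>x\<^sub>1 = x\<^sub>2\<close>, across that line.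
\<close>

lemma runge2_expands:
  assumes c: "c > 0" and h: "h > 0"
  shows "\<exists>x\<in>Rd 2. \<exists>y\<in>Rd 2.
    norm (runge2 h (\<lambda>z. - grad 2 (kinked_potential c) z) y
        - runge2 h (\<lambda>z. - grad 2 (kinked_potential c) z) x) > norm (y - x)"
proof -
  define \<alpha> where "\<alpha> = h / 2 * c"
  have \<alpha>: "\<alpha> > 0" using c h by (simp add: \<alpha>_def)
  \<comment> \<open>The first coordinate minus the second is \<open>0\<close> and \<open>1\<close> at the initial points, and becomes
     \<open>\<alpha> q\<close> and \<open>1 - 2 \<alpha> + \<alpha> q\<close> in the first stage; \<open>q\<close> is chosen to make both negative.\<close>
  define q where "q = - 1 / \<alpha>"
  have \<alpha>q: "\<alpha> * q = - 1" using \<alpha> by (simp add: q_def)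
  let ?F = "\<lambda>z. - grad 2 (kinked_potential c) z"
  have step: "runge2 h ?F (point a b) = point a b - h *\<^sub>R kinked_gradient c (point
      (a - \<alpha> * max 0 (a - b)) (b - \<alpha> * (b - max 0 (a - b))))" for a b
  proof -
    have "point a b - (h / 2) *\<^sub>R kinked_gradient c (point a b)
        = point (a - \<alpha> * max 0 (a - b)) (b - \<alpha> * (b - max 0 (a - b)))"
      by (simp add: kinked_gradient_point point_arith \<alpha>_def mult.assoc)
    then show ?thesis
      unfolding runge2_gradient by (simp only: grad_kinked_potential point_in_plane)
  qed
  have x: "runge2 h ?F (point q q) = point q (q - h * (c * (q + 1)))"
    unfolding step kinked_gradient_point point_arith using \<alpha>q by (simp add: algebra_simps)
  have y: "runge2 h ?F (point (q + 1) q) = point (q + 1) (q - h * (c * (q + 1 + \<alpha>)))"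
    unfolding step kinked_gradient_point point_arith using \<alpha>q \<alpha>
    by (simp add: algebra_simps max_def)
  have "runge2 h ?F (point (q + 1) q) - runge2 h ?F (point q q) = point 1 (- (h * c * \<alpha>))"
    unfolding x y point_arith by (simp add: algebra_simps)
  moreover have "point (q + 1) q - point q q = point 1 0"
    unfolding point_arith by simp
  moreover have "norm (point 1 0) < norm (point 1 (- (h * c * \<alpha>)))"
    by (rule power2_less_imp_less) (use c h \<alpha> in \<open>simp_all add: norm_point_squared\<close>)
  ultimately have "norm (runge2 h ?F (point (q + 1) q) - runge2 h ?F (point q q))
      > norm (point (q + 1) q - point q q)"
    by simp
  then show ?thesis using point_in_plane by blast
qed

theorem theorem3p1:
  fixes L :: real
  assumes "L > 0"
  shows "(\<exists>h\<^sub>0>0. \<forall>h\<in>{0<..h\<^sub>0}. \<exists>d\<ge>1. \<exists>V. convex_C1 d V \<and> L_smooth L d V \<and>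
            (\<exists>x\<^sub>0\<in>Rd d. \<exists>y\<^sub>0\<in>Rd d.
               let x\<^sub>1 = x\<^sub>0 - h *\<^sub>R grad d V (x\<^sub>0 - (h / 2) *\<^sub>R grad d V x\<^sub>0);
                   y\<^sub>1 = y\<^sub>0 - h *\<^sub>R grad d V (y\<^sub>0 - (h / 2) *\<^sub>R grad d V y\<^sub>0)
               in \<not> norm (y\<^sub>1 - x\<^sub>1) \<le> norm (y\<^sub>0 - x\<^sub>0)))
         \<and> \<not> (\<exists>h\<^sub>c. interval_of_convex_contractivity runge2 L h\<^sub>c)"
proof
  let ?V = "kinked_potential (L / 3)"
  have V: "convex_C1 2 ?V" "L_smooth L 2 ?V"
    using convex_kinked_potential[of "L / 3"] L_smooth_kinked_potential[of "L / 3"] assms by simp_all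
  have expands: "\<exists>x\<in>Rd 2. \<exists>y\<in>Rd 2. \<not> norm (runge2 h (\<lambda>z. - grad 2 ?V z) y
      - runge2 h (\<lambda>z. - grad 2 ?V z) x) \<le> norm (y - x)" if "h > 0" for h
    using runge2_expands[of "L / 3" h] that assms by (simp add: not_le)
  \<comment> \<open>Expansion holds for all positive \<open>h\<close>, so the bound \<open>1\<close> is an arbitrary choice.\<close>
  show "\<exists>h\<^sub>0>0. \<forall>h\<in>{0<..h\<^sub>0}. \<exists>d\<ge>1. \<exists>V. convex_C1 d V \<and> L_smooth L d V \<and>
      (\<exists>x\<^sub>0\<in>Rd d. \<exists>y\<^sub>0\<in>Rd d.
         let x\<^sub>1 = x\<^sub>0 - h *\<^sub>R grad d V (x\<^sub>0 - (h / 2) *\<^sub>R grad d V x\<^sub>0);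
             y\<^sub>1 = y\<^sub>0 - h *\<^sub>R grad d V (y\<^sub>0 - (h / 2) *\<^sub>R grad d V y\<^sub>0)
         in \<not> norm (y\<^sub>1 - x\<^sub>1) \<le> norm (y\<^sub>0 - x\<^sub>0))"
  proof (intro exI[of _ "1::real"] conjI ballI exI[of _ "2::nat"] exI[of _ ?V] V)
    fix h :: real assume "h \<in> {0<..1}"
    then show "\<exists>x\<^sub>0\<in>Rd 2. \<exists>y\<^sub>0\<in>Rd 2.
         let x\<^sub>1 = x\<^sub>0 - h *\<^sub>R grad 2 ?V (x\<^sub>0 - (h / 2) *\<^sub>R grad 2 ?V x\<^sub>0);
             y\<^sub>1 = y\<^sub>0 - h *\<^sub>R grad 2 ?V (y\<^sub>0 - (h / 2) *\<^sub>R grad 2 ?V y\<^sub>0)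
         in \<not> norm (y\<^sub>1 - x\<^sub>1) \<le> norm (y\<^sub>0 - x\<^sub>0)"
      using expands[of h] by (simp add: Let_def runge2_gradient)
  qed simp_all
  show "\<not> (\<exists>h\<^sub>c. interval_of_convex_contractivity runge2 L h\<^sub>c)"
  proof
    assume "\<exists>h\<^sub>c. interval_of_convex_contractivity runge2 L h\<^sub>c"
    then obtain h\<^sub>c where I: "interval_of_convex_contractivity runge2 L h\<^sub>c" ..
    then have pos: "h\<^sub>c > 0" by (simp add: interval_of_convex_contractivity_def)
    then have "h\<^sub>c \<in> {0<..h\<^sub>c}" "(2::nat) \<ge> 1" by simp_all
    then have "\<forall>x\<in>Rd 2. \<forall>y\<in>Rd 2. norm (runge2 h\<^sub>c (\<lambda>z. - grad 2 ?V z) y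
        - runge2 h\<^sub>c (\<lambda>z. - grad 2 ?V z) x) \<le> norm (y - x)"
      using I V unfolding interval_of_convex_contractivity_def by blast
    with expands[OF pos] show False by blast
  qed
qed

end
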